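(* Let $\sigma\in\mathfrak S_n$. Then $$\mathbf F_\sigma(\mathbb X)=q^{\mathrm{maj}(\sigma)}\prod_{i=1}^n\frac{1-q^{(i-1)x_i-iy_i}\,t}{1-q^i}=\prod_{i=1}^n\frac{q^{iy_i}-q^{(i-1)x_i}\,t}{1-q^i},$$ where $x_i=0$ if $\sigma_{i-1}>\sigma_i$ and $x_i=1$ otherwise, $y_i=0$ if $\sigma_i<\sigma_{i+1}$ and $y_i=1$ otherwise, with the conventions $\sigma_0=\sigma_{n+1}=+\infty$.
   Context: For $\mu\in\mathfrak S_N$ and $\epsilon\in\{\pm1\}^N$, the signed permutation $(\mu,\epsilon)$ is identified with the integer word $w=(\epsilon_1\mu_1,\dots,\epsilon_N\mu_N)$; $\mathrm{maj}(\mu,\epsilon)=\sum_{i:\,w_i>w_{i+1}}i$ (so $\mathrm{maj}(\mu)$, all signs $+1$, is the usual major index), and $m(\epsilon)$ is the number of entries $-1$ of $\epsilon$. Let $(q)_N=\prod_{i=1}^N(1-q^i)$. $\mathbf F_\mu$ denotes the basis element of the Hopf algebra $\mathbf{FQSym}$ of free quasi-symmetric functions indexed by $\mu$, and $\mathbb X=\frac{1}{1-q}\,\hat\times\,(1-t)$ is the virtual alphabet; the $(q,t)$-specialization of $\mathbf F_\mu$ at $\mathbb X$ is the rational function $$\mathbf F_\mu(\mathbb X)=\frac{1}{(q)_N}\sum_{\epsilon\in\{\pm1\}^N}(-t)^{m(\epsilon)}q^{\mathrm{maj}(\mu,\epsilon)}.$$ *)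

theory Defs
  imports
    "HOL-Computational_Algebra.Polynomial"
    "HOL-Computational_Algebra.Fraction_Field"
    "HOL-Combinatorics.Permutations"
    "HOL-Library.FuncSet"
    "HOL-Library.Extended_Nat"
begin

text \<open>
  Rational functions in the two indeterminates \<open>q\<close>, \<open>t\<close> over a field \<open>'k\<close> are the fraction
  field of \<open>'k[q][t]\<close>: the inner polynomial variable is \<open>q\<close>, the outer one is \<open>t\<close>.
\<close>

type_synonym 'k ratfun = "'k poly poly fract"

definition qvar :: "'k::field ratfun" where
  "qvar = Fract [:[:0, 1:]:] 1"

definition tvar :: "'k::field ratfun" where
  "tvar = Fract [:0, 1:] 1"

text \<open>
  Words of length \<open>N\<close> are functions on \<open>nat\<close> of which only the values at \<open>1, \<dots>, N\<close> matter.
\<close>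

definition maj_word :: "nat \<Rightarrow> (nat \<Rightarrow> int) \<Rightarrow> nat" where
  "maj_word N w = (\<Sum>i | 1 \<le> i \<and> i < N \<and> w i > w (i + 1). i)"

definition signed_word :: "(nat \<Rightarrow> nat) \<Rightarrow> (nat \<Rightarrow> int) \<Rightarrow> nat \<Rightarrow> int" where
  "signed_word \<mu> \<epsilon> i = \<epsilon> i * int (\<mu> i)"

definition maj_signed :: "nat \<Rightarrow> (nat \<Rightarrow> nat) \<Rightarrow> (nat \<Rightarrow> int) \<Rightarrow> nat" where
  "maj_signed N \<mu> \<epsilon> = maj_word N (signed_word \<mu> \<epsilon>)"

definition maj :: "nat \<Rightarrow> (nat \<Rightarrow> nat) \<Rightarrow> nat" where
  "maj N \<mu> = maj_signed N \<mu> (\<lambda>_. 1)"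

definition sign_vectors :: "nat \<Rightarrow> (nat \<Rightarrow> int) set" where
  "sign_vectors N = {1..N} \<rightarrow>\<^sub>E {1, -1}"

definition num_minus :: "nat \<Rightarrow> (nat \<Rightarrow> int) \<Rightarrow> nat" where
  "num_minus N \<epsilon> = card {i \<in> {1..N}. \<epsilon> i = -1}"

definition qfact :: "nat \<Rightarrow> 'k::field ratfun" where
  "qfact N = (\<Prod>i=1..N. 1 - qvar ^ i)"

text \<open>
  The specialization of the basis element of FQSym indexed by \<open>\<mu> \<in> S\<^sub>N\<close> at the virtual
  alphabet \<open>1/(1-q) \<times> (1-t)\<close>.
\<close>

definition F_spec :: "nat \<Rightarrow> (nat \<Rightarrow> nat) \<Rightarrow> 'k::field ratfun" where
  "F_spec N \<mu> = 1 / qfact N *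
     (\<Sum>\<epsilon>\<in>sign_vectors N. (- tvar) ^ num_minus N \<epsilon> * qvar ^ maj_signed N \<mu> \<epsilon>)"

text \<open>The one-line word of \<open>\<sigma>\<close> with the conventions \<open>\<sigma>\<^sub>0 = \<sigma>\<^sub>n\<^sub>+\<^sub>1 = \<infinity>\<close>.\<close>

definition ext_perm :: "nat \<Rightarrow> (nat \<Rightarrow> nat) \<Rightarrow> nat \<Rightarrow> enat" where
  "ext_perm n \<sigma> i = (if i \<in> {1..n} then enat (\<sigma> i) else \<infinity>)"

text \<open>Both exponents below are only used for \<open>1 \<le> i \<le> n\<close>, so \<open>i - 1\<close> does not truncate.\<close>

definition x_exp :: "nat \<Rightarrow> (nat \<Rightarrow> nat) \<Rightarrow> nat \<Rightarrow> nat" where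
  "x_exp n \<sigma> i = (if ext_perm n \<sigma> (i - 1) > ext_perm n \<sigma> i then 0 else 1)"

definition y_exp :: "nat \<Rightarrow> (nat \<Rightarrow> nat) \<Rightarrow> nat \<Rightarrow> nat" where
  "y_exp n \<sigma> i = (if ext_perm n \<sigma> i < ext_perm n \<sigma> (i + 1) then 0 else 1)"

end

theory Submission
  imports Defs
begin

text \<open>
  The word of a signed permutation descends at \<open>i\<close> iff \<open>\<sigma>\<^sub>i < \<sigma>\<^sub>i\<^sub>+\<^sub>1\<close> and \<open>\<epsilon>\<^sub>i\<^sub>+\<^sub>1 = -1\<close>, or
  \<open>\<sigma>\<^sub>i > \<sigma>\<^sub>i\<^sub>+\<^sub>1\<close> and \<open>\<epsilon>\<^sub>i = 1\<close>. So each descent is controlled by a single sign, and the major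
  index is a sum over \<open>i\<close> of terms depending on \<open>\<epsilon>\<^sub>i\<close> alone: \<open>i y\<^sub>i\<close> for a plus sign and
  \<open>(i - 1) x\<^sub>i\<close> for a minus sign. The sum over all sign vectors therefore factors.
\<close>

lemma qvar_nonzero: "(qvar :: 'k::field ratfun) \<noteq> 0"
  unfolding qvar_def by (simp add: Zero_fract_def eq_fract)

lemma maj_signed_eq_sum:
  assumes \<sigma>: "\<sigma> permutes {1..n}" and \<epsilon>: "\<And>i. i \<in> {1..n} \<Longrightarrow> \<epsilon> i = 1 \<or> \<epsilon> i = -1"
  shows "maj_signed n \<sigma> \<epsilon> =
    (\<Sum>i=1..n. if \<epsilon> i = 1 then i * y_exp n \<sigma> i else (i - 1) * x_exp n \<sigma> i)"
proof (cases n)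
  case 0
  then show ?thesis by (simp add: maj_signed_def maj_word_def)
next
  case (Suc m)
  \<comment> \<open>A descent between positions \<open>i\<close> and \<open>i + 1\<close> is charged
    to \<open>a i\<close> if a plus sign at \<open>i\<close> causes it, and to
    \<open>b (Suc i)\<close> if a minus sign at \<open>i + 1\<close> does.\<close>
  define a where "a i = (if \<epsilon> i = 1 then i * y_exp n \<sigma> i else 0)" for i
  define b where "b i = (if \<epsilon> i = 1 then 0 else (i - 1) * x_exp n \<sigma> i)" for i
  have step: "(if signed_word \<sigma> \<epsilon> i > signed_word \<sigma> \<epsilon> (i + 1) then i else 0) = a i + b (Suc i)"
    if i: "i \<in> {1..m}" for i
  proof -
    have mem: "i \<in> {1..n}" "Suc i \<in> {1..n}" using i Suc by auto
    \<comment> \<open>Positivity of the letters puts every negated letter below every unnegated one,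
      which settles the case of opposite signs.\<close>
    have pos: "\<sigma> i > 0" "\<sigma> (Suc i) > 0"
      using mem permutes_in_image[OF \<sigma>] by (metis atLeastAtMost_iff less_le_trans zero_less_one)+
    have ne: "\<sigma> i \<noteq> \<sigma> (Suc i)"
      using permutes_inj[OF \<sigma>] by (metis injD n_not_Suc_n)
    \<comment> \<open>Inside the word exactly one of \<open>y_exp n \<sigma> i\<close> and
      \<open>x_exp n \<sigma> (Suc i)\<close> is 1, so just one of the two signs decides.\<close>
    have y: "y_exp n \<sigma> i = (if \<sigma> i < \<sigma> (Suc i) then 0 else 1)"
      and x: "x_exp n \<sigma> (Suc i) = (if \<sigma> i < \<sigma> (Suc i) then 1 else 0)"
      using mem ne by (auto simp: y_exp_def x_exp_def ext_perm_def)
    show ?thesis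
      using \<epsilon>[OF mem(1)] \<epsilon>[OF mem(2)] pos ne
      by (auto simp: a_def b_def x y signed_word_def)
  qed
  have "maj_signed n \<sigma> \<epsilon> =
      (\<Sum>i=1..m. if signed_word \<sigma> \<epsilon> i > signed_word \<sigma> \<epsilon> (i + 1) then i else 0)"
    unfolding maj_signed_def maj_word_def Suc
    by (subst sum.inter_filter[symmetric]) (auto intro!: sum.cong)
  also have "\<dots> = (\<Sum>i=1..m. a i) + (\<Sum>i=1..m. b (Suc i))"
    unfolding sum.distrib[symmetric] by (intro sum.cong refl step)
  \<comment> \<open>The added term \<open>a n\<close> vanishes: the convention of an infinite letter
    at \<open>n + 1\<close> makes \<open>y_exp n \<sigma> n\<close> zero.\<close>
  also have "(\<Sum>i=1..m. a i) = (\<Sum>i=1..n. a i)"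
    using Suc by (simp add: a_def y_exp_def ext_perm_def)
  also have "(\<Sum>i=1..m. b (Suc i)) = (\<Sum>i=1..n. b i)"
  proof -
    have "(\<Sum>i=1..n. b i) = b 1 + (\<Sum>i=Suc 1..n. b i)"
      using Suc by (subst sum.atLeast_Suc_atMost) auto
    also have "(\<Sum>i=Suc 1..n. b i) = (\<Sum>i=1..m. b (Suc i))"
      unfolding Suc by (rule sum.shift_bounds_cl_Suc_ivl)
    \<comment> \<open>\<open>b 1\<close> vanishes because of its factor
      \<open>1 - 1\<close>.\<close>
    finally show ?thesis by (simp add: b_def)
  qed
  finally show ?thesis
    by (simp add: a_def b_def sum.distrib[symmetric] if_distrib cong: if_cong)
qed

text \<open>The all-plus case, which lets the prefactor \<open>qvar ^ maj n \<sigma>\<close> be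
  distributed over the factors of the product.\<close>

lemma maj_eq_sum:
  assumes "\<sigma> permutes {1..n}"
  shows "maj n \<sigma> = (\<Sum>i=1..n. i * y_exp n \<sigma> i)"
  unfolding maj_def by (simp add: maj_signed_eq_sum[OF assms])

text \<open>Expanding the product means picking one of two terms in each factor, that is, a sign
  vector. No division occurs, so any commutative ring will do.\<close>

lemma sum_sign_vectors_eq_prod:
  fixes q t :: "'a::comm_ring_1"
  assumes \<sigma>: "\<sigma> permutes {1..n}"
  shows "(\<Sum>\<epsilon>\<in>sign_vectors n. (- t) ^ num_minus n \<epsilon> * q ^ maj_signed n \<sigma> \<epsilon>) =
    (\<Prod>i=1..n. q ^ (i * y_exp n \<sigma> i) - q ^ ((i - 1) * x_exp n \<sigma> i) * t)"
proof -
  \<comment> \<open>\<open>f i s\<close> is the weight contributed by the sign \<open>s\<close> at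
    position \<open>i\<close>.\<close>
  define f where "f i s = (if s = 1 then q ^ (i * y_exp n \<sigma> i)
    else - t * q ^ ((i - 1) * x_exp n \<sigma> i))" for i and s :: int
  have summand: "(- t) ^ num_minus n \<epsilon> * q ^ maj_signed n \<sigma> \<epsilon> = (\<Prod>i=1..n. f i (\<epsilon> i))"
    if "\<epsilon> \<in> sign_vectors n" for \<epsilon>
  proof -
    have \<epsilon>: "\<epsilon> i = 1 \<or> \<epsilon> i = -1" if "i \<in> {1..n}" for i
      using PiE_mem[OF \<open>\<epsilon> \<in> sign_vectors n\<close>[unfolded sign_vectors_def] that] by simp
    have "(- t) ^ num_minus n \<epsilon> = (\<Prod>i=1..n. if \<epsilon> i = -1 then - t else 1)"
      unfolding num_minus_def by (subst prod.inter_filter[symmetric]) simp_all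
    moreover have "q ^ maj_signed n \<sigma> \<epsilon> =
        (\<Prod>i=1..n. q ^ (if \<epsilon> i = 1 then i * y_exp n \<sigma> i else (i - 1) * x_exp n \<sigma> i))"
      by (subst maj_signed_eq_sum[OF \<sigma> \<epsilon>]) (simp_all add: power_sum)
    ultimately have "(- t) ^ num_minus n \<epsilon> * q ^ maj_signed n \<sigma> \<epsilon> =
        (\<Prod>i=1..n. (if \<epsilon> i = -1 then - t else 1) *
          q ^ (if \<epsilon> i = 1 then i * y_exp n \<sigma> i else (i - 1) * x_exp n \<sigma> i))"
      by (simp only: prod.distrib)
    also have "\<dots> = (\<Prod>i=1..n. f i (\<epsilon> i))"
      using \<epsilon> by (intro prod.cong) (force simp: f_def)+
    finally show ?thesis .
  qed
  have "(\<Sum>\<epsilon>\<in>sign_vectors n. (- t) ^ num_minus n \<epsilon> * q ^ maj_signed n \<sigma> \<epsilon>) =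
      (\<Prod>i=1..n. \<Sum>s\<in>{1, -1}. f i s)"
    using summand by (subst prod_sum_PiE) (simp_all add: sign_vectors_def)
  then show ?thesis by (simp add: f_def mult.commute)
qed

theorem theorem3p9:
  fixes n :: nat and \<sigma> :: "nat \<Rightarrow> nat"
  assumes "\<sigma> permutes {1..n}"
  shows "(F_spec n \<sigma> :: 'k::field ratfun) =
           qvar ^ maj n \<sigma> *
           (\<Prod>i=1..n. (1 - qvar powi ((int i - 1) * int (x_exp n \<sigma> i) - int i * int (y_exp n \<sigma> i)) * tvar)
                      / (1 - qvar ^ i)) \<and>
         qvar ^ maj n \<sigma> *
           (\<Prod>i=1..n. (1 - qvar powi ((int i - 1) * int (x_exp n \<sigma> i) - int i * int (y_exp n \<sigma> i)) * tvar)
                      / (1 - qvar ^ i)) =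
           (\<Prod>i=1..n. (qvar ^ (i * y_exp n \<sigma> i) - qvar ^ ((i - 1) * x_exp n \<sigma> i) * tvar)
                      / (1 - qvar ^ i) :: 'k ratfun)"
    (is "_ = ?M \<and> ?M = ?R")
proof -
  \<comment> \<open>The share \<open>i * y_exp n \<sigma> i\<close> of the major index clears the
    negative part of the integer exponent.\<close>
  have factor: "qvar ^ (i * y_exp n \<sigma> i) *
        ((1 - qvar powi ((int i - 1) * int (x_exp n \<sigma> i) - int i * int (y_exp n \<sigma> i)) * tvar)
          / (1 - qvar ^ i)) =
      (qvar ^ (i * y_exp n \<sigma> i) - qvar ^ ((i - 1) * x_exp n \<sigma> i) * tvar)
        / (1 - qvar ^ i :: 'k ratfun)" if "i \<in> {1..n}" for i
  proof -
    \<comment> \<open>Since \<open>i\<close> is at least 1, natural and integer subtraction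
      agree.\<close>
    have "(int i - 1) * int (x_exp n \<sigma> i) = int ((i - 1) * x_exp n \<sigma> i)"
      using that by (simp add: of_nat_diff)
    then have "(qvar :: 'k ratfun) powi ((int i - 1) * int (x_exp n \<sigma> i) - int i * int (y_exp n \<sigma> i)) =
        qvar ^ ((i - 1) * x_exp n \<sigma> i) / qvar ^ (i * y_exp n \<sigma> i)"
      by (simp only: of_nat_mult[symmetric] power_int_diff[OF disjI1[OF qvar_nonzero]] power_int_of_nat)
    then show ?thesis by (simp add: qvar_nonzero field_simps)
  qed
  have "?M = ?R"
    unfolding maj_eq_sum[OF assms] power_sum prod.distrib[symmetric]
    by (intro prod.cong refl factor)
  moreover have "(F_spec n \<sigma> :: 'k ratfun) = ?R"
    unfolding F_spec_def qfact_def sum_sign_vectors_eq_prod[OF assms] prod_dividef by simp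
  ultimately show ?thesis by simp
qed

end
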